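(* Let $\mathcal{L}=(L,\wedge,\vee,0,1)$ be a complete lattice, let $X\subseteq L\setminus\{1\}$, and assume that $\mathcal{L}$ is an $X$-top lattice. The following conditions are equivalent for $A\subseteq X$: (1) $A$ is irreducible (as a subset of the topological space $(X,\tau)$); (2) $I(A)$ is strongly irreducible in $(\mathcal{C}(L),\wedge)$; (3) $I(A)$ is irreducible in $(\mathcal{C}(L),\wedge)$.
   Context: For $a\in L$ put $V(a)=\{p\in X\mid a\le p\}$. Put $\tau=\{X\setminus V(a)\mid a\in L\}$. The lattice $\mathcal{L}$ is called $X$-top iff the family $\{V(a)\mid a\in L\}$ is closed under finite unions (equivalently $\tau$ is a topology on $X$, whose closed sets are the $V(a)$). For $Y\subseteq X$ put $I(Y)=\bigwedge_{p\in Y}p$ (with the empty meet equal to $1$), and for $a\in L$ put $\sqrt a=I(V(a))$. Put $\mathcal{C}(L)=\{a\in L\mid \sqrt a=a\}$, the set of $X$-radical elements; it is closed under meets of $L$. A subset $A$ of a topological space is irreducible iff it is non-empty and, for any closed sets $F_1,F_2$ with $A\subseteq F_1\cup F_2$, one has $A\subseteq F_1$ or $A\subseteq F_2$. An element $x\in\mathcal{C}(L)\setminus\{1\}$ is strongly irreducible in $(\mathcal{C}(L),\wedge)$ iff for all $a,b\in\mathcal{C}(L)$ with $a\wedge b\le x$ one has $a\le x$ or $b\le x$; it is irreducible in $(\mathcal{C}(L),\wedge)$ iff for all $a,b\in\mathcal{C}(L)$ with $a\wedge b=x$ one has $a=x$ or $b=x$. *)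

theory Defs
  imports "HOL-Analysis.Abstract_Topology"
begin

text \<open>The complete lattice \<open>L\<close> is the whole type; \<open>0\<close>, \<open>1\<close> and \<open>I(Y)\<close> are \<^const>\<open>bot\<close>, \<^const>\<open>top\<close>
  and \<^term>\<open>Inf Y\<close> (in particular \<^prop>\<open>Inf {} = (top :: 'a :: complete_lattice)\<close>).\<close>

definition V :: "'a::complete_lattice set \<Rightarrow> 'a \<Rightarrow> 'a set" where
  "V X a = {p \<in> X. a \<le> p}"

definition X_top :: "'a::complete_lattice set \<Rightarrow> bool" where
  "X_top X \<longleftrightarrow> (\<forall>\<F>. finite \<F> \<and> \<F> \<subseteq> range (V X) \<longrightarrow> \<Union>\<F> \<in> range (V X))"

definition tau :: "'a::complete_lattice set \<Rightarrow> 'a set set" where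
  "tau X = {X - V X a | a. True}"

text \<open>Meaningful only if \<^term>\<open>tau X\<close> is a topology, i.e. for \<^term>\<open>X_top X\<close>; see \<open>istopology_tau_iff\<close>.\<close>

definition tau_topology :: "'a::complete_lattice set \<Rightarrow> 'a topology" where
  "tau_topology X = topology (\<lambda>U. U \<in> tau X)"

definition radical :: "'a::complete_lattice set \<Rightarrow> 'a \<Rightarrow> 'a" where
  "radical X a = Inf (V X a)"

definition radical_elements :: "'a::complete_lattice set \<Rightarrow> 'a set" where
  "radical_elements X = {a. radical X a = a}"

definition irreducible_subset :: "'a topology \<Rightarrow> 'a set \<Rightarrow> bool" where
  "irreducible_subset T A \<longleftrightarrow> A \<subseteq> topspace T \<and> A \<noteq> {} \<and>
     (\<forall>F1 F2. closedin T F1 \<and> closedin T F2 \<and> A \<subseteq> F1 \<union> F2 \<longrightarrow> A \<subseteq> F1 \<or> A \<subseteq> F2)"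

definition strongly_irreducible_in :: "'a::complete_lattice set \<Rightarrow> 'a \<Rightarrow> bool" where
  "strongly_irreducible_in C x \<longleftrightarrow> x \<in> C - {top} \<and>
     (\<forall>a\<in>C. \<forall>b\<in>C. inf a b \<le> x \<longrightarrow> a \<le> x \<or> b \<le> x)"

definition irreducible_in :: "'a::complete_lattice set \<Rightarrow> 'a \<Rightarrow> bool" where
  "irreducible_in C x \<longleftrightarrow> x \<in> C - {top} \<and>
     (\<forall>a\<in>C. \<forall>b\<in>C. inf a b = x \<longrightarrow> a = x \<or> b = x)"

lemma tau_Union:
  assumes "\<U> \<subseteq> tau X"
  shows "\<Union>\<U> \<in> tau X"
proof -
  let ?B = "{a. X - V X a \<in> \<U>}"
  have "\<Union>\<U> = (\<Union>a\<in>?B. X - V X a)"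
    using assms unfolding tau_def by blast
  also have "\<dots> = X - V X (Sup ?B)"
    unfolding V_def by (auto simp: Sup_le_iff)
  finally show ?thesis unfolding tau_def by blast
qed

lemma istopology_tau_iff:
  fixes X :: "'a::complete_lattice set"
  assumes "top \<notin> X"
  shows "istopology (\<lambda>U. U \<in> tau X) \<longleftrightarrow> X_top X"
proof
  assume ist: "istopology (\<lambda>U. U \<in> tau X)"
  have un: "V X a \<union> V X b \<in> range (V X)" for a b
  proof -
    have "(X - V X a) \<inter> (X - V X b) \<in> tau X"
      using ist unfolding istopology_def tau_def by blast
    then obtain c where c: "(X - V X a) \<inter> (X - V X b) = X - V X c"
      unfolding tau_def by blast
    have "V X a \<union> V X b = V X c"
      using c unfolding V_def by blast
    then show ?thesis by blast
  qed
  have em: "{} \<in> range (V X)"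
  proof
    show "{} = V X top"
      using assms unfolding V_def by (auto simp: top_unique)
  qed simp
  have "\<Union>\<F> \<in> range (V X)" if "finite \<F>" "\<F> \<subseteq> range (V X)" for \<F>
    using that
  proof (induction \<F> rule: finite_induct)
    case empty
    then show ?case using em by simp
  next
    case (insert F \<F>)
    then obtain a b where "F = V X a" "\<Union>\<F> = V X b" by blast
    then show ?case using un[of a b] by simp
  qed
  then show "X_top X" unfolding X_top_def by blast
next
  assume xt: "X_top X"
  have "S \<inter> T \<in> tau X" if "S \<in> tau X" "T \<in> tau X" for S T
  proof -
    from that obtain a b where ab: "S = X - V X a" "T = X - V X b"
      unfolding tau_def by blast
    have "\<Union>{V X a, V X b} \<in> range (V X)"
      using xt unfolding X_top_def by (metis empty_subsetI finite.emptyI finite.insertI insert_subset rangeI)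
    then obtain c where "V X a \<union> V X b = V X c" by auto
    then have "S \<inter> T = X - V X c" using ab by blast
    then show ?thesis unfolding tau_def by blast
  qed
  then show "istopology (\<lambda>U. U \<in> tau X)"
    unfolding istopology_def using tau_Union by blast
qed

end

theory Submission
  imports Defs
begin

text \<open>The maps \<^term>\<open>V X\<close> and \<^term>\<open>Inf\<close> form an antitone Galois connection between elements of the
  lattice and subsets of \<^term>\<open>X\<close>. Its fixed points are the closed sets on one side and the radical
  elements on the other, so these correspond bijectively and with the order reversed; the closure of
  \<^term>\<open>A\<close> is \<^term>\<open>V X (Inf A)\<close>.

  Because unions of closed sets are closed, the correspondence turns meets of radical elements into
  unions (\<open>V_inf_radical_elements\<close>). Thus an inequality \<^prop>\<open>inf a b \<le> Inf A\<close> between radical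
  elements is a covering of \<^term>\<open>A\<close> by two closed sets, and irreducibility of \<^term>\<open>A\<close> gives
  strong irreducibility of \<^term>\<open>Inf A\<close>. Strong irreducibility always implies irreducibility.
  For the way back from irreducibility, a covering of \<^term>\<open>A\<close> by closed sets is cut down to the
  closure of \<^term>\<open>A\<close>: the meets of the two pieces are then radical elements whose meet is exactly
  \<^term>\<open>Inf A\<close>.\<close>

lemma le_radical: "a \<le> radical X a"
  unfolding radical_def V_def by (auto intro: Inf_greatest)

lemma Inf_in_radical_elements:
  assumes "A \<subseteq> X"
  shows "Inf A \<in> radical_elements X"
proof -
  have "A \<subseteq> V X (Inf A)"
    using assms unfolding V_def by (auto intro: Inf_lower)
  then have "radical X (Inf A) \<le> Inf A"
    unfolding radical_def by (rule Inf_superset_mono)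
  with le_radical[of "Inf A" X] show ?thesis
    unfolding radical_elements_def by (simp add: antisym)
qed

lemma subset_V_iff: "A \<subseteq> X \<Longrightarrow> A \<subseteq> V X a \<longleftrightarrow> a \<le> Inf A"
  unfolding V_def by (auto simp: le_Inf_iff)

lemma V_radical: "V X (radical X a) = V X a"
proof
  show "V X (radical X a) \<subseteq> V X a"
    unfolding V_def using order_trans[OF le_radical] by blast
  show "V X a \<subseteq> V X (radical X a)"
    unfolding radical_def V_def by (auto intro: Inf_lower)
qed

lemma X_top_V_Un:
  assumes "X_top X"
  obtains c where "V X a \<union> V X b = V X c"
proof -
  have "\<Union>{V X a, V X b} \<in> range (V X)"
    using assms unfolding X_top_def
    by (metis empty_subsetI finite.emptyI finite.insertI insert_subset rangeI)
  then show thesis using that by auto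
qed

text \<open>The union is some closed set \<^term>\<open>V X c\<close>, and the radical of \<^term>\<open>c\<close>, being the meet of that
  union, can only be the meet of the two radicals.\<close>

lemma V_inf_radical_elements:
  assumes "X_top X" "a \<in> radical_elements X" "b \<in> radical_elements X"
  shows "V X (inf a b) = V X a \<union> V X b"
proof -
  obtain c where c: "V X a \<union> V X b = V X c"
    using X_top_V_Un[OF assms(1)] .
  have "radical X c = inf (radical X a) (radical X b)"
    unfolding radical_def c[symmetric] by (rule Inf_union_distrib)
  also have "\<dots> = inf a b"
    using assms(2,3) unfolding radical_elements_def by simp
  finally show ?thesis
    using c V_radical[of X c] by simp
qed

lemma
  assumes "top \<notin> X" "X_top X"
  shows topspace_tau_topology: "topspace (tau_topology X) = X"
    and closedin_tau_topology_iff: "closedin (tau_topology X) F \<longleftrightarrow> F \<in> range (V X)"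
proof -
  have open_iff: "openin (tau_topology X) U \<longleftrightarrow> U \<in> tau X" for U
    using istopology_tau_iff[OF assms(1)] assms(2)
    unfolding tau_topology_def by (simp add: topology_inverse')
  have V_sub: "V X a \<subseteq> X" for a unfolding V_def by blast
  have "V X top = {}"
    using assms(1) unfolding V_def by (auto simp: top_unique)
  then have "X \<in> tau X" unfolding tau_def by blast
  moreover have "\<Union>(tau X) \<subseteq> X" unfolding tau_def by blast
  ultimately show ts: "topspace (tau_topology X) = X"
    unfolding topspace_def open_iff by blast
  have "F \<subseteq> X \<and> X - F \<in> tau X \<longleftrightarrow> F \<in> range (V X)"
  proof
    assume F: "F \<subseteq> X \<and> X - F \<in> tau X"
    then obtain a where "X - F = X - V X a" unfolding tau_def by blast
    then have "F = V X a" using F V_sub[of a] by blast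
    then show "F \<in> range (V X)" by simp
  next
    assume "F \<in> range (V X)"
    then obtain a where "F = V X a" by blast
    then show "F \<subseteq> X \<and> X - F \<in> tau X"
      using V_sub unfolding tau_def by blast
  qed
  then show "closedin (tau_topology X) F \<longleftrightarrow> F \<in> range (V X)"
    unfolding closedin_def ts open_iff .
qed

lemma strongly_irreducible_in_imp_irreducible_in:
  "strongly_irreducible_in C x \<Longrightarrow> irreducible_in C x"
  unfolding strongly_irreducible_in_def irreducible_in_def
  by (metis inf.cobounded1 inf.cobounded2 order.antisym order_refl)

lemma irreducible_subset_imp_strongly_irreducible_in:
  assumes "top \<notin> X" "X_top X" and irr: "irreducible_subset (tau_topology X) A"
  shows "strongly_irreducible_in (radical_elements X) (Inf A)"
proof -
  have AX: "A \<subseteq> X" and ne: "A \<noteq> {}"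
    using irr unfolding irreducible_subset_def topspace_tau_topology[OF assms(1,2)] by auto
  obtain p where "p \<in> A" using ne by blast
  moreover from this have "p \<noteq> top"
    using AX assms(1) by blast
  ultimately have "Inf A \<noteq> top"
    by auto
  moreover have "a \<le> Inf A \<or> b \<le> Inf A"
    if ab: "a \<in> radical_elements X" "b \<in> radical_elements X" and le: "inf a b \<le> Inf A" for a b
  proof -
    have "A \<subseteq> V X a \<union> V X b"
      using le unfolding subset_V_iff[OF AX, symmetric] V_inf_radical_elements[OF assms(2) ab] .
    moreover have "closedin (tau_topology X) (V X a)" "closedin (tau_topology X) (V X b)"
      unfolding closedin_tau_topology_iff[OF assms(1,2)] by simp_all
    ultimately have "A \<subseteq> V X a \<or> A \<subseteq> V X b"
      using irr unfolding irreducible_subset_def by blast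
    then show ?thesis
      unfolding subset_V_iff[OF AX] .
  qed
  ultimately show ?thesis
    using Inf_in_radical_elements[OF AX] unfolding strongly_irreducible_in_def by blast
qed

text \<open>If \<^term>\<open>V X a\<close> and \<^term>\<open>V X b\<close> cover \<^term>\<open>A\<close>, their traces on the closure
  \<^term>\<open>V X (Inf A)\<close> are the closed sets of \<^term>\<open>sup a (Inf A)\<close> and \<^term>\<open>sup b (Inf A)\<close>. The union
  of the traces lies between \<^term>\<open>A\<close> and its closure, so its meet is \<^term>\<open>Inf A\<close>; hence one of the
  two radicals is \<^term>\<open>Inf A\<close>, which puts \<^term>\<open>A\<close> inside the corresponding closed set.\<close>

lemma irreducible_in_imp_irreducible_subset:
  assumes "top \<notin> X" "X_top X" and AX: "A \<subseteq> X"
    and irr: "irreducible_in (radical_elements X) (Inf A)"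
  shows "irreducible_subset (tau_topology X) A"
proof -
  have "A \<subseteq> V X a \<or> A \<subseteq> V X b" if cov: "A \<subseteq> V X a \<union> V X b" for a b
  proof -
    define G where "G c = V X (sup c (Inf A))" for c
    have A_le: "A \<subseteq> G a \<union> G b"
      using cov unfolding G_def V_def by (auto intro: Inf_lower)
    have le_cl: "G a \<union> G b \<subseteq> V X (Inf A)"
      unfolding G_def V_def by auto
    have "inf (Inf (G a)) (Inf (G b)) = Inf (G a \<union> G b)"
      by (rule Inf_union_distrib[symmetric])
    also have "\<dots> = Inf A"
    proof (rule antisym)
      show "Inf (G a \<union> G b) \<le> Inf A" using A_le by (rule Inf_superset_mono)
      show "Inf A \<le> Inf (G a \<union> G b)"
        using le_cl unfolding V_def by (auto intro!: Inf_greatest)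
    qed
    finally have meet: "inf (Inf (G a)) (Inf (G b)) = Inf A" .
    have "Inf (G c) \<in> radical_elements X" for c
      by (rule Inf_in_radical_elements) (auto simp: G_def V_def)
    then have cases: "Inf (G a) = Inf A \<or> Inf (G b) = Inf A"
      using irr meet unfolding irreducible_in_def by blast
    have "A \<subseteq> V X c" if "Inf (G c) = Inf A" for c
    proof -
      have "c \<le> Inf (G c)"
        using le_radical[of "sup c (Inf A)" X] unfolding G_def radical_def by simp
      then show ?thesis
        unfolding subset_V_iff[OF AX] that .
    qed
    with cases show ?thesis by blast
  qed
  moreover have "A \<noteq> {}"
    using irr unfolding irreducible_in_def by auto
  ultimately show ?thesis
    unfolding irreducible_subset_def topspace_tau_topology[OF assms(1,2)]
      closedin_tau_topology_iff[OF assms(1,2)]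
    using AX by blast
qed

theorem corollary1p23:
  fixes X A :: "'a::complete_lattice set"
  assumes "X \<subseteq> UNIV - {top}"
    and "X_top X"
    and "A \<subseteq> X"
  shows "(irreducible_subset (tau_topology X) A
            \<longleftrightarrow> strongly_irreducible_in (radical_elements X) (Inf A))
       \<and> (strongly_irreducible_in (radical_elements X) (Inf A)
            \<longleftrightarrow> irreducible_in (radical_elements X) (Inf A))"
proof -
  have "top \<notin> X" using assms(1) by blast
  then show ?thesis
    using irreducible_subset_imp_strongly_irreducible_in[of X A]
      strongly_irreducible_in_imp_irreducible_in[of "radical_elements X" "Inf A"]
      irreducible_in_imp_irreducible_subset[of X A] assms(2,3)
    by blast
qed

end
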